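(* (Reflection Theorem) For each integer $n>1$ let $\mathbb{P}_n$ be a probability mass function on $[n]=\{1,\dots,n\}$ with $\mathbb{P}_n(i)=\frac1n+\varepsilon_{i,n}$, and let $\alpha_n=n^{1/\log\log n}$. Suppose: (a) there is a constant $C\in\mathbb{R}$ with $\sum_{l=1}^{\lfloor n/p\rfloor}\varepsilon_{lp,n}\le C/p$ for all $n>1$ and all primes $p>\alpha_n$; (b) $\lim_{n\to\infty}\sum_{l=1}^{\lfloor n/p\rfloor}\varepsilon_{lp,n}=0$ for every prime $p$; (c) $\varepsilon_{i,n}\in[-\frac1n,\frac1n]$ for all $n$ and all $1\le i\le n$; (d) there exists a constant $D\ge0$ such that for all $n>1$, all $k\ge1$ and all $k$-tuples $(p_1,\dots,p_k)$ of distinct primes, $$-\frac Dn\le\sum_{l=1}^{\lfloor n/(p_1\cdots p_k)\rfloor}\varepsilon_{lp_1\cdots p_k,n}\le\frac Dn.$$ Define $\mathbb{P}^*_n(i)=\frac1n-\varepsilon_{i,n}$ for $1\le i\le n$. Then for every $x\in\mathbb{R}$, as $n\to\infty$, $$\mathbb{P}^*_n\left(m\le n:\ \omega(m)-\log\log n\le x(\log\log n)^{1/2}\right)\to\mathbb{P}(Z\le x),$$ where $Z$ is a standard normal random variable.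
   Context: $\omega(m)$ denotes the number of distinct prime factors of the positive integer $m$; $\log$ is the natural logarithm; $\lfloor\cdot\rfloor$ is the floor function. *)

theory Defs
  imports "HOL-Probability.Probability" "HOL-Number_Theory.Number_Theory"
begin

definition omega :: "nat \<Rightarrow> nat" where
  "omega m = card (prime_factors m)"

definition alpha :: "nat \<Rightarrow> real" where
  "alpha n = real n powr (1 / ln (ln (real n)))"

text \<open>
  The array \<open>\<epsilon>\<close> takes the point first and the level second, as in
  $\varepsilon_{i,n}$.
\<close>

definition reflected_mass :: "(nat \<Rightarrow> nat \<Rightarrow> real) \<Rightarrow> nat \<Rightarrow> nat \<Rightarrow> real" where
  "reflected_mass \<epsilon> n i = 1 / real n - \<epsilon> i n"

definition reflected_prob :: "(nat \<Rightarrow> nat \<Rightarrow> real) \<Rightarrow> nat \<Rightarrow> nat set \<Rightarrow> real" where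
  "reflected_prob \<epsilon> n A = (\<Sum>i \<in> A \<inter> {1..n}. reflected_mass \<epsilon> n i)"

text \<open>
  Under the assumptions made on \<open>\<epsilon>\<close>, \<open>reflected_mass\<close> is again a probability mass function
  on \<open>{1..n}\<close>, so that \<open>reflected_prob\<close> is the associated probability measure.
\<close>

lemma reflected_mass_pmf:
  fixes p :: "nat pmf" and \<epsilon> :: "nat \<Rightarrow> nat \<Rightarrow> real"
  assumes "n > 1" and supp: "set_pmf p \<subseteq> {1..n}"
    and mass: "\<And>i. i \<in> {1..n} \<Longrightarrow> pmf p i = 1 / real n + \<epsilon> i n"
    and bound: "\<And>i. i \<in> {1..n} \<Longrightarrow> \<epsilon> i n \<in> {- (1 / real n)..1 / real n}"
  shows "\<And>i. i \<in> {1..n} \<Longrightarrow> 0 \<le> reflected_mass \<epsilon> n i"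
    and "reflected_prob \<epsilon> n {1..n} = 1"
proof -
  show "0 \<le> reflected_mass \<epsilon> n i" if "i \<in> {1..n}" for i
    using bound[OF that] by (simp add: reflected_mass_def)
  have "(\<Sum>i\<in>{1..n}. pmf p i) = 1"
    using supp by (intro sum_pmf_eq_1) auto
  moreover have "(\<Sum>i\<in>{1..n}. pmf p i) = (\<Sum>i\<in>{1..n}. 1 / real n + \<epsilon> i n)"
    by (rule sum.cong[OF refl]) (rule mass)
  ultimately have "(\<Sum>i\<in>{1..n}. \<epsilon> i n) = 0"
    using \<open>n > 1\<close> by (simp add: sum.distrib)
  then show "reflected_prob \<epsilon> n {1..n} = 1"
    using \<open>n > 1\<close> by (simp add: reflected_prob_def reflected_mass_def sum_subtractf)
qed

end

theory Submission
  imports Defs "HOL-Computational_Algebra.Squarefree" "HOL-Real_Asymp.Real_Asymp"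
begin

text \<open>
  Condition (d) says that, under the reflected weights, every squarefree \<open>d\<close> divides with
  probability \<open>1/d + O(1/n)\<close>, so the claim is an Erdos-Kac theorem for these weights. It is proved
  with characteristic functions. Write \<open>L = ln (ln n)\<close>, \<open>z = exp (i t / sqrt L) - 1\<close> and
  \<open>y = n powr (1 / L\<^sup>2)\<close>. Prime factors above \<open>y\<close> contribute \<open>o(sqrt L)\<close> to \<open>\<omega>\<close> on average. For the
  primes up to \<open>y\<close>, expanding \<open>(1 + z) ^ #{p \<le> y. p dvd m}\<close> over the squarefree divisors of \<open>m\<close>
  and discarding those with more than \<open>L\<close> prime factors compares the expectation with
  \<open>\<Prod>(1 + z / p)\<close>: the kept divisors are at most \<open>y ^ L = n powr (1 / L)\<close>, so that the errors
  \<open>O(1/n)\<close> add up to \<open>o(1)\<close>, and the discarded ones are negligible because \<open>|z| = O(1 / sqrt L)\<close>.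
  The product is close to \<open>exp (z \<Sum>1/p)\<close>, and \<open>\<Sum>1/p = L + O(ln L)\<close> gives the Gaussian limit.
\<close>

section \<open>Sums of reciprocals of primes\<close>

text \<open>Carries each passage between a product over a set of primes and a sum over its subsets;
  the subsets stand for the squarefree numbers composed of those primes.\<close>

lemma prod_one_plus_eq_sum_Pow:
  fixes f :: "'a \<Rightarrow> 'b :: comm_semiring_1"
  assumes "finite A"
  shows "(\<Prod>x\<in>A. 1 + f x) = (\<Sum>B\<in>Pow A. \<Prod>x\<in>B. f x)"
  using prod_add[OF assms, of f "\<lambda>_. 1"] by (simp add: add.commute)

lemma prime_factors_prod_primes:
  fixes B :: "nat set"
  assumes "finite B" "\<And>p. p \<in> B \<Longrightarrow> prime p"
  shows "prime_factors (\<Prod>B) = B"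
proof -
  have "0 \<notin> (\<lambda>p. p) ` B" using assms(2)[of 0] by auto
  with assms(1) have "prime_factors (\<Prod>B) = \<Union>((prime_factors \<circ> (\<lambda>p. p)) ` B)"
    by (rule prime_factors_prod)
  also have "\<dots> = (\<Union>p\<in>B. {p})"
    using assms(2) by (auto simp: prime_factorization_prime)
  finally show ?thesis by simp
qed

text \<open>Unique factorisation: \<open>prime_factors\<close> inverts the product. Sums over sets
  of primes can thus be reindexed by integers, and such sets can be counted by their
  products.\<close>

lemma inj_on_prod_primes:
  fixes A :: "nat set"
  assumes "finite A" "\<And>p. p \<in> A \<Longrightarrow> prime p"
  shows "inj_on (\<lambda>B. \<Prod>B) (Pow A)"
proof (rule inj_on_inverseI)
  fix B assume "B \<in> Pow A"
  then show "prime_factors (\<Prod>B) = B"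
    using assms by (intro prime_factors_prod_primes) (auto intro: finite_subset)
qed

lemma prod_primes_dvd_iff:
  fixes B :: "nat set"
  assumes "finite B" "\<And>p. p \<in> B \<Longrightarrow> prime p"
  shows "\<Prod>B dvd m \<longleftrightarrow> (\<forall>p\<in>B. p dvd m)"
  using assms
proof (induction B rule: finite_induct)
  case (insert p B)
  have "coprime p (\<Prod>B)"
    using insert by (intro prod_coprime_right) (auto intro: primes_coprime)
  then have "p * \<Prod>B dvd m \<longleftrightarrow> p dvd m \<and> \<Prod>B dvd m"
    by (meson divides_mult dvd_mult_left dvd_mult_right)
  then show ?case using insert by simp
qed simp

lemma sum_inverse_squares_le: "(\<Sum>k = 1..N. 1 / real k ^ 2) \<le> 2"
proof -
  \<comment> \<open>The induction needs the telescoping remainder; starting from one term makes the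
    base case an equality.\<close>
  have "(\<Sum>k = 1..Suc N. 1 / real k ^ 2) \<le> 2 - 1 / real (Suc N)" for N
  proof (induction N)
    case (Suc N)
    have "1 / real (Suc (Suc N)) ^ 2 \<le> 1 / (real (Suc N) * real (Suc (Suc N)))"
      by (intro divide_left_mono) (auto simp: power2_eq_square)
    also have "\<dots> = 1 / real (Suc N) - 1 / real (Suc (Suc N))"
      by (simp add: field_simps)
    finally show ?case using Suc.IH by simp
  qed simp
  from this[of N] have "(\<Sum>k = 1..Suc N. 1 / real k ^ 2) \<le> 2"
    by (rule order_trans) simp
  moreover have "(\<Sum>k = 1..N. 1 / real k ^ 2) \<le> (\<Sum>k = 1..Suc N. 1 / real k ^ 2)"
    by (intro sum_mono2) auto
  ultimately show ?thesis by linarith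
qed

lemma squarefree_eq_prod_prime_factors:
  fixes d :: nat
  assumes "squarefree d"
  shows "d = \<Prod>(prime_factors d)"
proof -
  have "d > 0" using assms by (cases "d = 0") simp_all
  then have "d = (\<Prod>p\<in>prime_factors d. p ^ multiplicity p d)"
    by (rule prime_factorization_nat)
  also have "\<dots> = (\<Prod>p\<in>prime_factors d. p)"
  proof (rule prod.cong[OF refl])
    fix p assume p: "p \<in> prime_factors d"
    then have "multiplicity p d \<le> 1" "multiplicity p d > 0"
      using assms \<open>d > 0\<close> squarefree_factorial_semiring''[of d]
      by (auto simp: prime_factors_multiplicity)
    then have "multiplicity p d = 1" by linarith
    then show "p ^ multiplicity p d = p" by simp
  qed
  finally show ?thesis .
qed

definition primes_le :: "real \<Rightarrow> nat set" where
  "primes_le x = {p. prime p \<and> real p \<le> x}"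

lemma mem_primes_le_iff: "p \<in> primes_le x \<longleftrightarrow> prime p \<and> real p \<le> x"
  by (simp add: primes_le_def)

lemma finite_primes_le [simp, intro]: "finite (primes_le x)"
proof (rule finite_subset)
  show "primes_le x \<subseteq> {..nat \<lceil>x\<rceil>}"
    unfolding primes_le_def by (auto, linarith)
qed simp

text \<open>Finite form of Euler's argument for the divergence of the sum of prime reciprocals: the
  squarefree parts are absorbed by the product, the squares by the constant 2, which bounds the sum
  of inverse squares.\<close>

lemma harm_le_prod_primes:
  "harm N \<le> 2 * (\<Prod>p\<in>primes_le (real N). 1 + 1 / real p)"
proof -
  let ?A = "primes_le (real N)"
  \<comment> \<open>Every \<open>n\<close> is a squarefree number times a square.\<close>
  let ?g = "\<lambda>n. (prime_factors (squarefree_part n), square_part n)"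
  have dec: "n = \<Prod>(prime_factors (squarefree_part n)) * square_part n ^ 2" for n :: nat
    using squarefree_decompose[of n] squarefree_eq_prod_prime_factors[of "squarefree_part n"]
    by simp
  have inj: "inj_on ?g {1..N}"
  proof (rule inj_onI)
    fix m n :: nat assume "?g m = ?g n"
    then show "m = n" by (metis dec prod.inject)
  qed
  have sub: "?g ` {1..N} \<subseteq> Pow ?A \<times> {1..N}"
  proof safe
    fix n p assume n: "n \<in> {1..N}" and p: "p \<in> prime_factors (squarefree_part n)"
    have "p dvd n"
      using p squarefree_decompose[of n] by (metis dvd_mult2 in_prime_factors_imp_dvd)
    then have "p \<le> n" using n by (auto intro: dvd_imp_le)
    then show "p \<in> ?A" using n p by (auto simp: primes_le_def)
  next
    fix n assume n: "n \<in> {1..N}"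
    have "square_part n dvd n"
      by (rule dvd_trans[OF _ square_part_square_dvd]) (simp add: power2_eq_square)
    then have "square_part n \<le> n" using n by (auto intro: dvd_imp_le)
    moreover have "square_part n > 0" using n by (simp add: zero_less_iff_neq_zero)
    ultimately show "square_part n \<in> {1..N}" using n by simp
  qed
  have "harm N = (\<Sum>n = 1..N. 1 / real n)"
    by (simp add: harm_def inverse_eq_divide)
  also have "\<dots> = (\<Sum>n = 1..N. (\<lambda>(B, k). (\<Prod>p\<in>B. 1 / real p) * (1 / real k ^ 2)) (?g n))"
  proof (rule sum.cong[OF refl])
    fix n
    have "1 / real n = 1 / ((\<Prod>p\<in>prime_factors (squarefree_part n). real p) * real (square_part n) ^ 2)"
      by (subst dec) simp
    also have "\<dots> = (\<lambda>(B, k). (\<Prod>p\<in>B. 1 / real p) * (1 / real k ^ 2)) (?g n)"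
      by (simp add: prod_dividef)
    finally show "1 / real n = (\<lambda>(B, k). (\<Prod>p\<in>B. 1 / real p) * (1 / real k ^ 2)) (?g n)" .
  qed
  also have "\<dots> = (\<Sum>(B, k)\<in>?g ` {1..N}. (\<Prod>p\<in>B. 1 / real p) * (1 / real k ^ 2))"
    by (subst sum.reindex[OF inj]) simp
  \<comment> \<open>All terms are nonnegative, so the image may be enlarged to a full rectangle,
    over which the double sum factors.\<close>
  also have "\<dots> \<le> (\<Sum>(B, k)\<in>Pow ?A \<times> {1..N}. (\<Prod>p\<in>B. 1 / real p) * (1 / real k ^ 2))"
    by (intro sum_mono2 sub) (auto intro!: mult_nonneg_nonneg prod_nonneg divide_nonneg_nonneg)
  also have "\<dots> = (\<Sum>B\<in>Pow ?A. \<Prod>p\<in>B. 1 / real p) * (\<Sum>k = 1..N. 1 / real k ^ 2)"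
    by (simp add: sum_product sum.cartesian_product)
  also have "\<dots> \<le> (\<Sum>B\<in>Pow ?A. \<Prod>p\<in>B. 1 / real p) * 2"
    by (intro mult_left_mono sum_inverse_squares_le sum_nonneg prod_nonneg) auto
  also have "(\<Sum>B\<in>Pow ?A. \<Prod>p\<in>B. 1 / real p) = (\<Prod>p\<in>?A. 1 + 1 / real p)"
    by (subst prod_one_plus_eq_sum_Pow) auto
  finally show ?thesis by simp
qed

text \<open>Logarithms of the chain \<open>ln x \<le> harm N \<le> 2 * \<Prod>(1 + 1/p) \<le> 2 *
  exp (\<Sum>1/p)\<close>; the loss \<open>ln 2\<close> comes from the factor 2.\<close>

lemma sum_inverse_primes_lower:
  assumes "x > 1"
  shows "ln (ln x) - ln 2 \<le> (\<Sum>p\<in>primes_le x. 1 / real p)"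
proof -
  define N where "N = nat \<lfloor>x\<rfloor>"
  have N: "primes_le (real N) = primes_le x"
  proof (rule Set.set_eqI)
    fix p
    have "real p \<le> real N \<longleftrightarrow> real p \<le> x"
    proof
      assume "real p \<le> real N"
      then show "real p \<le> x" unfolding N_def using assms of_nat_floor[of x] by linarith
    next
      assume "real p \<le> x"
      then have "p \<le> N" unfolding N_def by (rule le_nat_floor)
      then show "real p \<le> real N" by simp
    qed
    then show "p \<in> primes_le (real N) \<longleftrightarrow> p \<in> primes_le x"
      by (simp add: primes_le_def)
  qed
  have "x \<le> real N + 1"
    unfolding N_def using assms by linarith
  then have "ln x \<le> ln (real N + 1)"
    using assms by (subst ln_le_cancel_iff) simp_all
  also have "\<dots> \<le> harm N" by (rule ln_le_harm)
  also have "\<dots> \<le> 2 * (\<Prod>p\<in>primes_le x. 1 + 1 / real p)"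
    using harm_le_prod_primes[of N] N by simp
  also have "\<dots> \<le> 2 * exp (\<Sum>p\<in>primes_le x. 1 / real p)"
    unfolding exp_sum[OF finite_primes_le]
    by (intro mult_left_mono prod_mono conjI exp_ge_add_one_self) simp_all
  finally have le: "ln x \<le> 2 * exp (\<Sum>p\<in>primes_le x. 1 / real p)" .
  then have "ln (ln x) \<le> ln (2 * exp (\<Sum>p\<in>primes_le x. 1 / real p))"
    using assms by (subst ln_le_cancel_iff) auto
  then show ?thesis by (simp add: ln_mult)
qed

section \<open>Upper bound for the sum of prime reciprocals\<close>

lemma sum_powr_le_zeta_bound:
  fixes \<delta> :: real
  assumes "\<delta> > 0"
  shows "(\<Sum>n = 1..N. real n powr - (1 + \<delta>)) \<le> 1 + 1 / \<delta>"
proof -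
  have "(\<Sum>n = 1..Suc N. real n powr - (1 + \<delta>)) \<le> 1 + (1 - real (Suc N) powr - \<delta>) / \<delta>" for N
  proof (induction N)
    case (Suc N)
    \<comment> \<open>The mean value theorem for \<open>u powr - \<delta>\<close> on a unit interval
      takes the place of comparing the sum with the integral of
      \<open>u powr - (1 + \<delta>)\<close>.\<close>
    have "\<exists>z>real (Suc N). z < real (Suc (Suc N)) \<and>
        real (Suc (Suc N)) powr - \<delta> - real (Suc N) powr - \<delta> =
        (real (Suc (Suc N)) - real (Suc N)) * (- \<delta> * z powr (- \<delta> - 1))"
      by (rule MVT2) (auto intro!: derivative_eq_intros)
    then obtain z where z: "z > real (Suc N)" "z < real (Suc (Suc N))"
      "real (Suc N) powr - \<delta> - real (Suc (Suc N)) powr - \<delta> = \<delta> * z powr (- \<delta> - 1)"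
      by (auto simp: algebra_simps)
    have "real (Suc (Suc N)) powr (- \<delta> - 1) \<le> z powr (- \<delta> - 1)"
      using z assms by (intro powr_mono2') auto
    also have "\<dots> = (real (Suc N) powr - \<delta> - real (Suc (Suc N)) powr - \<delta>) / \<delta>"
      using z assms by simp
    finally have "real (Suc (Suc N)) powr - (1 + \<delta>) \<le>
      (real (Suc N) powr - \<delta> - real (Suc (Suc N)) powr - \<delta>) / \<delta>"
      by (simp only: minus_add_distrib diff_conv_add_uminus add.commute)
    then show ?case using Suc.IH
      by (simp add: diff_divide_distrib)
  qed simp
  from this[of N] have *: "(\<Sum>n = 1..Suc N. real n powr - (1 + \<delta>)) \<le> 1 + 1 / \<delta>"
    by (rule order_trans) (use assms in \<open>simp add: divide_right_mono\<close>)
  have "(\<Sum>n = 1..N. real n powr - (1 + \<delta>)) \<le> (\<Sum>n = 1..Suc N. real n powr - (1 + \<delta>))"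
    by (intro sum_mono2) auto
  with * show ?thesis by linarith
qed

text \<open>Expanding the product gives a sum of \<open>d powr - (1 + \<delta>)\<close> over
  distinct integers \<open>d\<close>, which is at most a partial zeta sum. The bound does not depend
  on \<open>A\<close>.\<close>

lemma prod_primes_powr_le:
  fixes \<delta> :: real
  assumes "\<delta> > 0" "finite A" "\<And>p. p \<in> A \<Longrightarrow> prime p"
  shows "(\<Prod>p\<in>A. 1 + real p powr - (1 + \<delta>)) \<le> 1 + 1 / \<delta>"
proof -
  have prod_powr: "(\<Prod>p\<in>B. real p powr - (1 + \<delta>)) = real (\<Prod>B) powr - (1 + \<delta>)" for B
    by (simp add: prod_powr_distrib)
  have "(\<Prod>p\<in>A. 1 + real p powr - (1 + \<delta>)) = (\<Sum>B\<in>Pow A. real (\<Prod>B) powr - (1 + \<delta>))"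
    using assms by (simp only: prod_one_plus_eq_sum_Pow prod_powr)
  also have "\<dots> = (\<Sum>d\<in>(\<lambda>B. \<Prod>B) ` Pow A. real d powr - (1 + \<delta>))"
    using inj_on_prod_primes[of A] assms by (subst sum.reindex) (auto simp: o_def)
  also have "\<dots> \<le> (\<Sum>d = 1..\<Prod>A. real d powr - (1 + \<delta>))"
  proof (rule sum_mono2)
    show "(\<lambda>B. \<Prod>B) ` Pow A \<subseteq> {1..\<Prod>A}"
    proof safe
      fix B assume B: "B \<subseteq> A"
      have pos: "p > 0" if "p \<in> A" for p using that assms(3) prime_gt_0_nat by blast
      have "\<Prod>B dvd \<Prod>A" using B assms by (intro prod_dvd_prod_subset) auto
      moreover have "\<Prod>A > 0" "\<Prod>B > 0" using pos B by (auto intro!: prod_pos)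
      ultimately show "\<Prod>B \<in> {1..\<Prod>A}" by (auto intro: dvd_imp_le)
    qed
  qed auto
  also have "\<dots> \<le> 1 + 1 / \<delta>" using assms by (intro sum_powr_le_zeta_bound)
  finally show ?thesis .
qed

lemma sum_inverse_primes_squares_le: "(\<Sum>p\<in>primes_le x. 1 / real p ^ 2) \<le> 2"
proof -
  have "(\<Sum>p\<in>primes_le x. 1 / real p ^ 2) \<le> (\<Sum>k = 1..nat \<lceil>x\<rceil>. 1 / real k ^ 2)"
  proof (rule sum_mono2)
    show "primes_le x \<subseteq> {1..nat \<lceil>x\<rceil>}"
    proof
      fix p assume "p \<in> primes_le x"
      then have "p \<ge> 1" "real p \<le> x" using prime_ge_1_nat[of p] by (simp_all add: primes_le_def)
      then show "p \<in> {1..nat \<lceil>x\<rceil>}" by (simp, linarith)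
    qed
  qed auto
  with sum_inverse_squares_le show ?thesis by (meson order_trans)
qed

text \<open>Allows a sum over primes to be traded for the logarithm of a product; the loss is
  quadratic, hence summable over the primes. Beyond \<open>u = 1\<close> the square alone
  suffices.\<close>

lemma le_ln_one_plus_sq: "u \<le> ln (1 + u) + u ^ 2" if "u \<ge> 0" for u :: real
proof (cases "u \<le> 1")
  case True
  then show ?thesis using ln_one_plus_pos_lower_bound[of u] that by simp
next
  case False
  then have "u * 1 \<le> u * u" "ln (1 + u) \<ge> 0" by (auto intro!: mult_left_mono)
  then show ?thesis by (simp add: power2_eq_square)
qed

text \<open>A weak form of Mertens' theorem: the excess over \<open>L\<close> is
  \<open>O(ln L)\<close>, which disappears after division by \<open>sqrt L\<close>.\<close>

lemma sum_inverse_primes_upper: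
  fixes n :: nat
  defines "L \<equiv> ln (ln (real n))"
  assumes "L \<ge> 1"
  shows "(\<Sum>p\<in>primes_le (real n). 1 / real p) \<le> exp (1 / L) * (L + ln L + ln 2 + 2)"
proof -
  let ?A = "primes_le (real n)"
  \<comment> \<open>\<open>ln\<close> is total and \<open>ln 0 = 0\<close>; the degenerate values
    \<open>n = 0\<close> and \<open>n = 1\<close> give \<open>L = 0\<close> and are excluded by
    \<open>L \<ge> 1\<close>.\<close>
  have ln_n: "ln (real n) > 1"
  proof (rule ccontr)
    assume "\<not> ln (real n) > 1"
    moreover have "ln (real n) \<ge> 0" by (cases "n = 0") auto
    ultimately have "L \<le> 0" unfolding L_def by (cases "ln (real n) = 0") auto
    with \<open>L \<ge> 1\<close> show False by simp
  qed
  have n: "real n > 1"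
    using ln_n by (cases "n = 0"; cases "n = 1") auto
  define \<delta> where "\<delta> = 1 / (L * ln (real n))"
  have \<delta>: "\<delta> > 0" using assms ln_n by (simp add: \<delta>_def)
  have n\<delta>: "real n powr \<delta> = exp (1 / L)"
    using n ln_n by (simp add: powr_def \<delta>_def)
  have prime: "prime p" "real p \<le> real n" "real p \<ge> 1" if "p \<in> ?A" for p
    using that prime_ge_1_nat[of p] by (auto simp: primes_le_def)
  \<comment> \<open>Rankin's trick: \<open>n powr \<delta> = exp (1 / L)\<close> is \<open>1 + O(1 / L)\<close>, while \<open>ln (1 / \<delta>)\<close> is still \<open>L + ln L\<close>.\<close>
  have "(\<Sum>p\<in>?A. 1 / real p) \<le> (\<Sum>p\<in>?A. exp (1 / L) * real p powr - (1 + \<delta>))"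
  proof (rule sum_mono)
    fix p assume p: "p \<in> ?A"
    have "1 / real p = real p powr \<delta> * real p powr - (1 + \<delta>)"
      using prime[OF p] by (simp add: powr_add[symmetric] powr_minus_divide)
    also have "\<dots> \<le> real n powr \<delta> * real p powr - (1 + \<delta>)"
      using prime[OF p] \<delta> by (intro mult_right_mono powr_mono2) auto
    finally show "1 / real p \<le> exp (1 / L) * real p powr - (1 + \<delta>)"
      by (simp add: n\<delta>)
  qed
  also have "\<dots> = exp (1 / L) * (\<Sum>p\<in>?A. real p powr - (1 + \<delta>))"
    by (simp add: sum_distrib_left)
  also have "(\<Sum>p\<in>?A. real p powr - (1 + \<delta>)) \<le>
      (\<Sum>p\<in>?A. ln (1 + real p powr - (1 + \<delta>)) + 1 / real p ^ 2)"
  proof (rule sum_mono)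
    fix p assume p: "p \<in> ?A"
    have "real p powr - (1 + \<delta>) \<le> real p powr - 1"
      using prime[OF p] \<delta> by (intro powr_mono) auto
    then have "(real p powr - (1 + \<delta>)) ^ 2 \<le> (real p powr - 1) ^ 2"
      by (intro power_mono) auto
    also have "\<dots> = 1 / real p ^ 2"
      using prime[OF p] by (simp add: powr_minus_divide power_divide)
    finally show "real p powr - (1 + \<delta>) \<le> ln (1 + real p powr - (1 + \<delta>)) + 1 / real p ^ 2"
      using le_ln_one_plus_sq[of "real p powr - (1 + \<delta>)"] by simp
  qed
  also have "\<dots> = ln (\<Prod>p\<in>?A. 1 + real p powr - (1 + \<delta>)) + (\<Sum>p\<in>?A. 1 / real p ^ 2)"
    by (subst ln_prod) (auto simp: sum.distrib add_pos_nonneg less_imp_neq[OF add_pos_nonneg, symmetric])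
  also have "\<dots> \<le> ln (1 + 1 / \<delta>) + 2"
  proof (intro add_mono sum_inverse_primes_squares_le)
    have "(\<Prod>p\<in>?A. 1 + real p powr - (1 + \<delta>)) > 0"
      by (intro prod_pos) (auto simp: add_pos_nonneg)
    then show "ln (\<Prod>p\<in>?A. 1 + real p powr - (1 + \<delta>)) \<le> ln (1 + 1 / \<delta>)"
      using prod_primes_powr_le[OF \<delta>, of ?A] prime \<delta> by (subst ln_le_cancel_iff) (auto simp: add_pos_pos)
  qed
  also have "ln (1 + 1 / \<delta>) \<le> ln (2 * (L * ln (real n)))"
  proof -
    have "1 * 1 \<le> L * ln (real n)" using assms ln_n by (intro mult_mono) auto
    then show ?thesis using \<delta> by (subst ln_le_cancel_iff) (auto simp: \<delta>_def)
  qed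
  also have "ln (2 * (L * ln (real n))) = ln 2 + ln L + L"
    using assms ln_n by (simp add: ln_mult L_def)
  finally show ?thesis by (simp add: algebra_simps)
qed

section \<open>Expansion over squarefree divisors\<close>

text \<open>For probability weights this is the probability that \<open>d\<close> divides a random
  point; the divisor expansion sees the weights only through these numbers.\<close>

definition multiples_mass :: "(nat \<Rightarrow> real) \<Rightarrow> nat \<Rightarrow> nat \<Rightarrow> real" where
  "multiples_mass w n d = (\<Sum>i\<in>{i \<in> {1..n}. d dvd i}. w i)"

text \<open>Expands \<open>(1 + z) ^ k\<close> over the sets of primes dividing \<open>i\<close> and
  exchanges the two sums. With \<open>1 + z\<close> of modulus 1, the left side is a value of the
  characteristic function of the number of prime divisors in \<open>A\<close>.\<close>

lemma sum_power_count_divisors: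
  fixes z :: complex
  assumes "finite A" "\<And>p. p \<in> A \<Longrightarrow> prime p"
  shows "(\<Sum>i = 1..n. of_real (w i) * (1 + z) ^ card {p \<in> A. p dvd i}) =
         (\<Sum>B\<in>Pow A. z ^ card B * of_real (multiples_mass w n (\<Prod>B)))"
proof -
  have expand: "(1 + z) ^ card {p \<in> A. p dvd i} = (\<Sum>B\<in>Pow A. if \<Prod>B dvd i then z ^ card B else 0)" for i
  proof -
    \<comment> \<open>Factors 1 at the primes not dividing \<open>i\<close> make the index set
      independent of \<open>i\<close>, so that the sums can be exchanged later.\<close>
    have "(1 + z) ^ card {p \<in> A. p dvd i} = (\<Prod>p\<in>A. if p dvd i then 1 + z else 1)"
      using assms(1) by (simp add: prod.If_cases Int_def)
    also have "\<dots> = (\<Prod>p\<in>A. 1 + (if p dvd i then z else 0))"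
      by (intro prod.cong) auto
    also have "\<dots> = (\<Sum>B\<in>Pow A. \<Prod>p\<in>B. if p dvd i then z else 0)"
      using assms(1) by (rule prod_one_plus_eq_sum_Pow)
    also have "\<dots> = (\<Sum>B\<in>Pow A. if \<Prod>B dvd i then z ^ card B else 0)"
    proof (rule sum.cong[OF refl])
      fix B assume "B \<in> Pow A"
      then have B: "finite B" "\<And>p. p \<in> B \<Longrightarrow> prime p"
        using assms by (auto intro: finite_subset)
      show "(\<Prod>p\<in>B. if p dvd i then z else 0) = (if \<Prod>B dvd i then z ^ card B else 0)"
      proof (cases "\<forall>p\<in>B. p dvd i")
        case True
        then have "(\<Prod>p\<in>B. if p dvd i then z else 0) = (\<Prod>p\<in>B. z)"
          by (intro prod.cong) auto
        with True show ?thesis by (simp add: prod_primes_dvd_iff[OF B])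
      next
        case False
        then have "(\<Prod>p\<in>B. if p dvd i then z else 0) = 0"
          using B(1) by (auto intro!: prod_zero)
        moreover have "\<not> \<Prod>B dvd i" using False by (simp add: prod_primes_dvd_iff[OF B])
        ultimately show ?thesis by simp
      qed
    qed
    finally show ?thesis .
  qed
  have "(\<Sum>i = 1..n. of_real (w i) * (1 + z) ^ card {p \<in> A. p dvd i}) =
      (\<Sum>i = 1..n. \<Sum>B\<in>Pow A. of_real (w i) * (if \<Prod>B dvd i then z ^ card B else 0))"
    by (simp only: expand sum_distrib_left)
  also have "\<dots> = (\<Sum>B\<in>Pow A. \<Sum>i = 1..n. of_real (w i) * (if \<Prod>B dvd i then z ^ card B else 0))"
    by (rule sum.swap)
  also have "\<dots> = (\<Sum>B\<in>Pow A. z ^ card B * of_real (multiples_mass w n (\<Prod>B)))"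
  proof (rule sum.cong[OF refl])
    fix B
    have "(\<Sum>i = 1..n. of_real (w i) * (if \<Prod>B dvd i then z ^ card B else 0)) =
        (\<Sum>i = 1..n. if \<Prod>B dvd i then z ^ card B * of_real (w i) else 0)"
      by (intro sum.cong) auto
    also have "\<dots> = (\<Sum>i\<in>{i \<in> {1..n}. \<Prod>B dvd i}. z ^ card B * of_real (w i))"
      by (rule sum.inter_filter[symmetric]) simp
    finally show "(\<Sum>i = 1..n. of_real (w i) * (if \<Prod>B dvd i then z ^ card B else 0)) =
        z ^ card B * of_real (multiples_mass w n (\<Prod>B))"
      by (simp add: multiples_mass_def sum_distrib_left)
  qed
  finally show ?thesis .
qed

text \<open>Distinct subsets have distinct products, and a product of at most \<open>K\<close>
  members of \<open>A\<close> is an integer between 1 and \<open>y ^ K\<close>.\<close>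

lemma card_small_subsets_primes_le:
  assumes "finite A" "\<And>p. p \<in> A \<Longrightarrow> prime p" "\<And>p. p \<in> A \<Longrightarrow> real p \<le> y" "y \<ge> 1"
  shows "real (card {B \<in> Pow A. card B \<le> K}) \<le> y ^ K"
proof -
  let ?S = "{B \<in> Pow A. card B \<le> K}"
  have "inj_on (\<lambda>B. \<Prod>B) ?S"
    by (rule inj_on_subset[OF inj_on_prod_primes[OF assms(1,2)]]) auto
  moreover have "(\<lambda>B. \<Prod>B) ` ?S \<subseteq> {1..nat \<lfloor>y ^ K\<rfloor>}"
  proof
    fix d assume "d \<in> (\<lambda>B. \<Prod>B) ` ?S"
    then obtain B where B: "B \<subseteq> A" "card B \<le> K" "d = \<Prod>B" by auto
    have "real d = (\<Prod>p\<in>B. real p)" using B by simp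
    also have "\<dots> \<le> (\<Prod>p\<in>B. y)" using B assms by (intro prod_mono) auto
    also have "\<dots> = y ^ card B" by simp
    also have "\<dots> \<le> y ^ K" using B assms by (intro power_increasing) auto
    finally have "d \<le> nat \<lfloor>y ^ K\<rfloor>" by (rule le_nat_floor)
    moreover have "d \<ge> 1"
    proof -
      have "\<Prod>B > 0" using B assms(2) prime_gt_0_nat by (intro prod_pos) blast
      then show ?thesis using B by simp
    qed
    ultimately show "d \<in> {1..nat \<lfloor>y ^ K\<rfloor>}" by simp
  qed
  ultimately have "card ?S \<le> card {1..nat \<lfloor>y ^ K\<rfloor>}"
    by (intro card_inj_on_le) auto
  then have "real (card ?S) \<le> real (nat \<lfloor>y ^ K\<rfloor>)" by simp
  also have "\<dots> \<le> y ^ K" using assms by (intro of_nat_floor) simp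
  finally show ?thesis .
qed

text \<open>The difference is a sum over subsets \<open>B\<close> of \<open>z ^ card B\<close> times
  the error at \<open>\<Prod>B\<close>. The uniform bound \<open>E\<close> serves the at most
  \<open>y ^ K\<close> small subsets; for the others the bound \<open>1 / \<Prod>B\<close> is summed
  against powers of \<open>norm z\<close>.\<close>

lemma truncated_expansion_bound:
  fixes z :: complex
  assumes A: "finite A" "\<And>p. p \<in> A \<Longrightarrow> prime p" "\<And>p. p \<in> A \<Longrightarrow> real p \<le> y"
    and y: "y \<ge> 1" and z: "norm z \<le> 1"
    and small: "\<And>B. B \<subseteq> A \<Longrightarrow> \<bar>multiples_mass w n (\<Prod>B) - 1 / real (\<Prod>B)\<bar> \<le> E"
    and large: "\<And>B. B \<subseteq> A \<Longrightarrow> \<bar>multiples_mass w n (\<Prod>B) - 1 / real (\<Prod>B)\<bar> \<le> 1 / real (\<Prod>B)"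
  shows "norm ((\<Sum>i = 1..n. of_real (w i) * (1 + z) ^ card {p \<in> A. p dvd i}) -
               (\<Prod>p\<in>A. 1 + z / of_nat p))
         \<le> E * y ^ K + exp (exp 1 * norm z * (\<Sum>p\<in>A. 1 / real p) - real K)"
proof -
  let ?W = "multiples_mass w n"
  let ?S = "{B \<in> Pow A. card B \<le> K}"
  have "E \<ge> 0" using small[of "{}"] by (rule order_trans[OF abs_ge_zero]) simp
  have fin: "finite B" if "B \<in> Pow A" for B using that A(1) by (auto intro: finite_subset)
  have "(\<Prod>p\<in>A. 1 + z / of_nat p) = (\<Sum>B\<in>Pow A. \<Prod>p\<in>B. z / of_nat p)"
    using A(1) by (rule prod_one_plus_eq_sum_Pow)
  also have "\<dots> = (\<Sum>B\<in>Pow A. z ^ card B * of_real (1 / real (\<Prod>B)))"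
    by (simp add: prod_dividef)
  finally have "(\<Sum>i = 1..n. of_real (w i) * (1 + z) ^ card {p \<in> A. p dvd i}) - (\<Prod>p\<in>A. 1 + z / of_nat p)
      = (\<Sum>B\<in>Pow A. z ^ card B * of_real (?W (\<Prod>B) - 1 / real (\<Prod>B)))"
    by (simp only: sum_power_count_divisors[OF A(1,2)] sum_subtractf of_real_diff right_diff_distrib)
  then have "norm ((\<Sum>i = 1..n. of_real (w i) * (1 + z) ^ card {p \<in> A. p dvd i}) - (\<Prod>p\<in>A. 1 + z / of_nat p))
      \<le> (\<Sum>B\<in>Pow A. norm z ^ card B * \<bar>?W (\<Prod>B) - 1 / real (\<Prod>B)\<bar>)"
    by (auto intro!: order_trans[OF norm_sum] sum_mono simp: norm_mult norm_power simp del: of_real_diff of_nat_prod)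
  \<comment> \<open>The tail term is charged to the small subsets as well, so that its sum over all
    subsets is a product.\<close>
  also have "\<dots> \<le> (\<Sum>B\<in>Pow A. (if card B \<le> K then E else 0) +
      exp (- real K) * (\<Prod>p\<in>B. exp 1 * norm z / real p))"
  proof (rule sum_mono)
    fix B assume B: "B \<in> Pow A"
    have nonneg: "0 \<le> exp (- real K) * (\<Prod>p\<in>B. exp 1 * norm z / real p)"
      by (intro mult_nonneg_nonneg prod_nonneg) auto
    show "norm z ^ card B * \<bar>?W (\<Prod>B) - 1 / real (\<Prod>B)\<bar> \<le> (if card B \<le> K then E else 0) +
      exp (- real K) * (\<Prod>p\<in>B. exp 1 * norm z / real p)"
    proof (cases "card B \<le> K")
      case True
      have "norm z ^ card B * \<bar>?W (\<Prod>B) - 1 / real (\<Prod>B)\<bar> \<le> 1 * E"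
        using B z small[of B] by (intro mult_mono power_le_one) auto
      with True nonneg show ?thesis by simp
    next
      case False
      have "norm z ^ card B * \<bar>?W (\<Prod>B) - 1 / real (\<Prod>B)\<bar> \<le> norm z ^ card B * (1 / real (\<Prod>B))"
        using B large[of B] by (intro mult_left_mono) auto
      \<comment> \<open>This exponential tilt bounds the tail by a full product.\<close>
      also have "\<dots> \<le> exp (real (card B) - real K) * (norm z ^ card B * (1 / real (\<Prod>B)))"
      proof -
        have "1 \<le> exp (real (card B) - real K)" using False by simp
        moreover have "0 \<le> norm z ^ card B * (1 / real (\<Prod>B))" by (intro mult_nonneg_nonneg) (auto simp del: of_nat_prod)
        ultimately show ?thesis by (metis mult_right_mono mult_1)
      qed
      also have "\<dots> = exp (- real K) * (\<Prod>p\<in>B. exp 1 * norm z / real p)"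
      proof -
        have "exp (real (card B) - real K) = exp (- real K) * exp 1 ^ card B"
          using exp_of_nat_mult[of "card B" "1 :: real"] by (simp add: exp_diff exp_minus divide_inverse)
        moreover have "(\<Prod>p\<in>B. exp 1 * norm z / real p) = exp 1 ^ card B * (norm z ^ card B * (1 / real (\<Prod>B)))"
          by (simp add: prod_dividef power_mult_distrib)
        ultimately show ?thesis by (simp only: mult.assoc)
      qed
      finally show ?thesis using False by simp
    qed
  qed
  also have "\<dots> = E * real (card ?S) + exp (- real K) * (\<Prod>p\<in>A. 1 + exp 1 * norm z / real p)"
  proof -
    have "(\<Sum>B\<in>Pow A. if card B \<le> K then E else 0) = E * real (card ?S)"
      using A(1) by (subst sum.inter_filter[symmetric]) auto
    moreover have "(\<Sum>B\<in>Pow A. \<Prod>p\<in>B. exp 1 * norm z / real p) = (\<Prod>p\<in>A. 1 + exp 1 * norm z / real p)"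
      using A(1) by (rule prod_one_plus_eq_sum_Pow[symmetric])
    ultimately show ?thesis by (simp only: sum.distrib sum_distrib_left[symmetric])
  qed
  also have "\<dots> \<le> E * y ^ K + exp (- real K) * exp (\<Sum>p\<in>A. exp 1 * norm z / real p)"
  proof (intro add_mono mult_left_mono)
    show "real (card ?S) \<le> y ^ K" using A y by (rule card_small_subsets_primes_le)
    show "(\<Prod>p\<in>A. 1 + exp 1 * norm z / real p) \<le> exp (\<Sum>p\<in>A. exp 1 * norm z / real p)"
      unfolding exp_sum[OF A(1)] by (intro prod_mono conjI exp_ge_add_one_self) simp
  qed (use \<open>E \<ge> 0\<close> in auto)
  also have "exp (- real K) * exp (\<Sum>p\<in>A. exp 1 * norm z / real p) =
      exp (exp 1 * norm z * (\<Sum>p\<in>A. 1 / real p) - real K)"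
    by (simp add: exp_add[symmetric] sum_distrib_left)
  finally show ?thesis .
qed

section \<open>Comparison of the product over primes with an exponential\<close>

lemma norm_one_plus_minus_exp_le:
  fixes w :: complex
  assumes "norm w \<le> 1"
  shows "norm (1 + w - exp w) \<le> 3 * norm w ^ 2"
proof -
  have "norm (exp w - (\<Sum>i\<le>1. w ^ i / fact i)) \<le> exp \<bar>Re w\<bar> * norm w ^ Suc 1 / fact 1"
    by (rule Taylor_exp)
  then have "norm (1 + w - exp w) \<le> exp \<bar>Re w\<bar> * norm w ^ 2"
    by (simp add: norm_minus_commute power2_eq_square)
  also have "exp \<bar>Re w\<bar> \<le> exp 1"
    using abs_Re_le_cmod[of w] assms by simp
  also have "exp (1 :: real) \<le> 3" by (rule exp_le)
  finally show ?thesis by (simp add: mult_right_mono)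
qed

text \<open>All factors of both products have modulus at most 1, so the products differ by at most
  the sum of the factorwise differences. Each of these is at most
  \<open>3 * norm z ^ 2 / p ^ 2\<close>, and the inverse squares add up to at most 2.\<close>

lemma prod_one_plus_div_primes_approx:
  fixes z :: complex
  assumes "norm (1 + z) \<le> 1" "norm z \<le> 1"
  shows "norm ((\<Prod>p\<in>primes_le x. 1 + z / of_nat p) - exp (z * of_real (\<Sum>p\<in>primes_le x. 1 / real p)))
         \<le> 6 * norm z ^ 2"
proof -
  let ?A = "primes_le x"
  have p1: "real p \<ge> 1" if "p \<in> ?A" for p
    using that prime_ge_1_nat[of p] by (simp add: primes_le_def)
  have "Re (1 + z) \<le> 1" using assms(1) complex_Re_le_cmod[of "1 + z"] by linarith
  then have Re: "Re z \<le> 0" by simp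
  have "exp (z * of_real (\<Sum>p\<in>?A. 1 / real p)) = (\<Prod>p\<in>?A. exp (z / of_nat p))"
    by (simp add: exp_sum sum_distrib_left)
  then have "norm ((\<Prod>p\<in>?A. 1 + z / of_nat p) - exp (z * of_real (\<Sum>p\<in>?A. 1 / real p)))
      = norm ((\<Prod>p\<in>?A. 1 + z / of_nat p) - (\<Prod>p\<in>?A. exp (z / of_nat p)))"
    by simp
  also have "\<dots> \<le> (\<Sum>p\<in>?A. norm (1 + z / of_nat p - exp (z / of_nat p)))"
  proof (rule norm_prod_diff)
    fix p assume p: "p \<in> ?A"
    \<comment> \<open>\<open>1 + z / p\<close> is a convex combination of 1 and
      \<open>1 + z\<close>, so it stays in the unit disc.\<close>
    have "1 + z / of_nat p = of_real (1 - 1 / real p) + of_real (1 / real p) * (1 + z)"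
      by (simp add: add_divide_distrib)
    also have "norm \<dots> \<le> \<bar>1 - 1 / real p\<bar> + \<bar>1 / real p\<bar> * norm (1 + z)"
      by (rule order_trans[OF norm_triangle_ineq]) (simp only: norm_mult norm_of_real order_refl)
    also have "\<dots> \<le> (1 - 1 / real p) + 1 / real p * 1"
      using p1[OF p] assms by (intro add_mono mult_mono) auto
    finally show "norm (1 + z / of_nat p) \<le> 1" by simp
    show "norm (exp (z / of_nat p)) \<le> 1"
      using Re p1[OF p] by (simp add: Re_divide_of_nat divide_nonpos_nonneg)
  qed
  also have "\<dots> \<le> (\<Sum>p\<in>?A. 3 * norm z ^ 2 * (1 / real p ^ 2))"
  proof (rule sum_mono)
    fix p assume p: "p \<in> ?A"
    have "norm (z / of_nat p) \<le> 1"
      using p1[OF p] assms by (simp add: norm_divide divide_le_eq)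
    then show "norm (1 + z / of_nat p - exp (z / of_nat p)) \<le> 3 * norm z ^ 2 * (1 / real p ^ 2)"
      using norm_one_plus_minus_exp_le[of "z / of_nat p"] by (simp add: norm_divide power_divide)
  qed
  also have "\<dots> = 3 * norm z ^ 2 * (\<Sum>p\<in>?A. 1 / real p ^ 2)"
    by (simp only: sum_distrib_left)
  also have "\<dots> \<le> 3 * norm z ^ 2 * 2"
    by (intro mult_left_mono sum_inverse_primes_squares_le) simp
  finally show ?thesis by simp
qed

text \<open>Translates the sum over multiples, natural for divisor expansions, into the sum over
  cofactors \<open>l\<close> used in condition (d).\<close>

lemma multiples_mass_eq_sum:
  assumes "d > 0"
  shows "multiples_mass w n d = (\<Sum>l = 1..n div d. w (l * d))"
  unfolding multiples_mass_def
proof (rule sum.reindex_bij_witness[where i = "\<lambda>l. l * d" and j = "\<lambda>i. i div d"])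
  fix i assume i: "i \<in> {i \<in> {1..n}. d dvd i}"
  then have "i div d \<noteq> 0" using assms by (auto simp: dvd_div_eq_0_iff)
  then show "i div d \<in> {1..n div d}" using i by (auto intro: div_le_mono)
next
  fix l assume l: "l \<in> {1..n div d}"
  then have "l * d \<le> n div d * d" by simp
  also have "\<dots> \<le> n" by simp
  finally show "l * d \<in> {i \<in> {1..n}. d dvd i}" using l assms by (simp add: Suc_le_eq)
qed (use assms in auto)

section \<open>Truncation level\<close>

definition loglog :: "nat \<Rightarrow> real" where
  "loglog n = ln (ln (real n))"

text \<open>With \<open>L = loglog n\<close>, the exponent balances two needs: products of at most
  \<open>L\<close> primes up to the cutoff stay within \<open>n powr (1 / L)\<close>, and
  \<open>ln (ln (cutoff n))\<close> is still \<open>L - 2 * ln L\<close>, so that little of the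
  reciprocal sum is lost.\<close>

definition cutoff :: "nat \<Rightarrow> real" where
  "cutoff n = real n powr (1 / loglog n ^ 2)"

definition small_sum :: "nat \<Rightarrow> real" where
  "small_sum n = (\<Sum>p\<in>primes_le (cutoff n). 1 / real p)"

definition full_sum :: "nat \<Rightarrow> real" where
  "full_sum n = (\<Sum>p\<in>primes_le (real n). 1 / real p)"

lemma loglog_at_top: "filterlim loglog at_top sequentially"
  unfolding loglog_def by real_asymp

text \<open>The threshold 2 later bounds \<open>n powr (1 / loglog n)\<close> by
  \<open>n powr (1 / 2)\<close>.\<close>

lemma eventually_large: "eventually (\<lambda>n. n > 1 \<and> loglog n \<ge> 2 \<and> ln (real n) > 0) sequentially"
proof -
  have "eventually (\<lambda>n. loglog n \<ge> 2) sequentially"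
    using loglog_at_top by (simp add: filterlim_at_top)
  with eventually_gt_at_top[of 1] show ?thesis
    by eventually_elim auto
qed

lemma cutoff_bounds:
  assumes "n > 1" "loglog n \<ge> 2"
  shows "cutoff n > 1" "cutoff n \<le> real n"
proof -
  show "cutoff n > 1" unfolding cutoff_def using assms by (intro gr_one_powr) auto
  have "1 / loglog n ^ 2 \<le> 1"
    using assms power_mono[of 1 "loglog n" 2] by (simp add: divide_le_eq)
  then have "cutoff n \<le> real n powr 1" unfolding cutoff_def
    using assms by (intro powr_mono) auto
  then show "cutoff n \<le> real n" using assms by simp
qed

lemma sum_bounds:
  assumes "n > 1" "loglog n \<ge> 2" "ln (real n) > 0"
  shows "loglog n - 2 * ln (loglog n) - ln 2 \<le> small_sum n"
    and "small_sum n \<le> full_sum n"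
    and "full_sum n \<le> exp (1 / loglog n) * (loglog n + ln (loglog n) + ln 2 + 2)"
proof -
  have "ln (cutoff n) = ln (real n) / loglog n ^ 2"
    using assms by (simp add: cutoff_def ln_powr)
  then have "ln (ln (cutoff n)) = loglog n - 2 * ln (loglog n)"
    using assms by (simp add: ln_div ln_realpow loglog_def)
  then show "loglog n - 2 * ln (loglog n) - ln 2 \<le> small_sum n"
    unfolding small_sum_def using sum_inverse_primes_lower[of "cutoff n"] cutoff_bounds[OF assms(1,2)] by simp
  show "small_sum n \<le> full_sum n"
    unfolding small_sum_def full_sum_def using cutoff_bounds[OF assms(1,2)]
    by (intro sum_mono2) (auto simp: primes_le_def)
  show "full_sum n \<le> exp (1 / loglog n) * (loglog n + ln (loglog n) + ln 2 + 2)"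
    unfolding full_sum_def using sum_inverse_primes_upper[of n] assms by (simp add: loglog_def)
qed

text \<open>Both sums are trapped between the same two expressions, each \<open>L + O(ln L)\<close>.
  Subtracting the two limits shows that the primes between the cutoff and \<open>n\<close> carry
  only \<open>o(sqrt L)\<close> of the reciprocal sum.\<close>

lemma sum_asymptotics:
  shows "(\<lambda>n. (small_sum n - loglog n) / sqrt (loglog n)) \<longlonglongrightarrow> 0"
    and "(\<lambda>n. (full_sum n - loglog n) / sqrt (loglog n)) \<longlonglongrightarrow> 0"
proof -
  have up: "(\<lambda>n. (exp (1 / loglog n) * (loglog n + ln (loglog n) + ln 2 + 2) - loglog n) / sqrt (loglog n)) \<longlonglongrightarrow> 0"
    by (rule filterlim_compose[OF _ loglog_at_top]) real_asymp
  have lo: "(\<lambda>n. (loglog n - 2 * ln (loglog n) - ln 2 - loglog n) / sqrt (loglog n)) \<longlonglongrightarrow> 0"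
    by (rule filterlim_compose[OF _ loglog_at_top]) real_asymp
  have sandwich: "(\<lambda>n. (f n - loglog n) / sqrt (loglog n)) \<longlonglongrightarrow> 0"
    if f: "\<And>n. n > 1 \<Longrightarrow> loglog n \<ge> 2 \<Longrightarrow> ln (real n) > 0 \<Longrightarrow> small_sum n \<le> f n \<and> f n \<le> full_sum n" for f
  proof (rule tendsto_sandwich[OF _ _ lo up])
    show "eventually (\<lambda>n. (loglog n - 2 * ln (loglog n) - ln 2 - loglog n) / sqrt (loglog n)
        \<le> (f n - loglog n) / sqrt (loglog n)) sequentially"
      using eventually_large
    proof eventually_elim
      case (elim n)
      then show ?case using sum_bounds[of n] f[of n] by (intro divide_right_mono) auto
    qed
    show "eventually (\<lambda>n. (f n - loglog n) / sqrt (loglog n) \<le>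
        (exp (1 / loglog n) * (loglog n + ln (loglog n) + ln 2 + 2) - loglog n) / sqrt (loglog n)) sequentially"
      using eventually_large
    proof eventually_elim
      case (elim n)
      then show ?case using sum_bounds[of n] f[of n] by (intro divide_right_mono) auto
    qed
  qed
  show "(\<lambda>n. (small_sum n - loglog n) / sqrt (loglog n)) \<longlonglongrightarrow> 0"
    and "(\<lambda>n. (full_sum n - loglog n) / sqrt (loglog n)) \<longlonglongrightarrow> 0"
    using sum_bounds(2) by (auto intro!: sandwich)
qed

text \<open>For \<open>z = iexp (t / sqrt L) - 1\<close> one has
  \<open>z * L = \<i> * t * sqrt L - t\<^sup>2 / 2 + o(1)\<close>: the first term cancels the
  centring phase, the second is the Gaussian exponent. As \<open>z\<close> is
  \<open>O(1 / sqrt L)\<close>, replacing \<open>L\<close> by \<open>small_sum n\<close> costs only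
  \<open>o(1)\<close>.\<close>

lemma exp_small_sum_limit:
  "(\<lambda>n. iexp (- t * sqrt (loglog n)) * exp ((iexp (t / sqrt (loglog n)) - 1) * of_real (small_sum n)))
     \<longlonglongrightarrow> of_real (exp (- (t\<^sup>2) / 2))"
proof -
  define r where "r n = (small_sum n - loglog n) / sqrt (loglog n)" for n
  have r: "r \<longlonglongrightarrow> 0" unfolding r_def by (rule sum_asymptotics)
  \<comment> \<open>\<open>a\<close> and \<open>c\<close> are the real and imaginary parts of
    \<open>sqrt L * z\<close>, \<open>b\<close> and \<open>d\<close> those of \<open>L * z\<close>
    without the phase \<open>t * sqrt L\<close>. Since \<open>small_sum = r * sqrt L + L\<close>,
    the total exponent is \<open>r * (a + \<i> * c) + (b + \<i> * d)\<close>.\<close>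
  define a where "a n = sqrt (loglog n) * (cos (t / sqrt (loglog n)) - 1)" for n
  define b where "b n = loglog n * (cos (t / sqrt (loglog n)) - 1)" for n
  define c where "c n = sqrt (loglog n) * sin (t / sqrt (loglog n))" for n
  define d where "d n = loglog n * sin (t / sqrt (loglog n)) - t * sqrt (loglog n)" for n
  have a: "a \<longlonglongrightarrow> 0" unfolding a_def by (rule filterlim_compose[OF _ loglog_at_top]) real_asymp
  have b: "b \<longlonglongrightarrow> - (t * t / 2)" unfolding b_def
    by (rule filterlim_compose[OF _ loglog_at_top]) real_asymp
  have c: "c \<longlonglongrightarrow> t" unfolding c_def by (rule filterlim_compose[OF _ loglog_at_top]) real_asymp
  have d: "d \<longlonglongrightarrow> 0" unfolding d_def by (rule filterlim_compose[OF _ loglog_at_top]) real_asymp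
  have "(\<lambda>n. exp (Complex (r n * a n + b n) (r n * c n + d n))) \<longlonglongrightarrow>
      exp (Complex (0 * 0 + - (t * t / 2)) (0 * t + 0))"
    by (intro tendsto_exp tendsto_Complex tendsto_add tendsto_mult r a b c d)
  also have "exp (Complex (0 * 0 + - (t * t / 2)) (0 * t + 0)) = of_real (exp (- (t\<^sup>2) / 2))"
    by (simp add: Complex_eq exp_of_real[symmetric] power2_eq_square)
  finally show ?thesis
  proof (rule Lim_transform_eventually)
    show "eventually (\<lambda>n. exp (Complex (r n * a n + b n) (r n * c n + d n)) =
        iexp (- t * sqrt (loglog n)) * exp ((iexp (t / sqrt (loglog n)) - 1) * of_real (small_sum n))) sequentially"
      using eventually_large
    proof eventually_elim
      case (elim n)
      define s where "s = sqrt (loglog n)"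
      have s: "s > 0" "loglog n = s * s" using elim by (simp_all add: s_def)
      have mu: "small_sum n = r n * s + s * s"
        using s by (simp add: r_def s_def[symmetric] field_simps)
      have "Complex (r n * a n + b n) (r n * c n + d n) =
          \<i> * of_real (- t * s) + (iexp (t / s) - 1) * of_real (small_sum n)"
        by (rule complex_eqI)
          (simp_all add: a_def b_def c_def d_def mu s_def[symmetric] s(2) abs_of_pos[OF s(1)] Re_exp Im_exp algebra_simps)
      then show ?case by (simp only: exp_add s_def)
    qed
  qed
qed

section \<open>An Erdos-Kac theorem for equidistributed weights\<close>

lemma iexp_diff_le: "norm (iexp a - iexp b) \<le> \<bar>a - b\<bar>"
proof -
  have "iexp a - iexp b = iexp b * (iexp (a - b) - 1)"
    by (simp add: right_diff_distrib exp_add[symmetric])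
  then have "norm (iexp a - iexp b) = norm (iexp (a - b) - 1)"
    by (simp add: norm_mult)
  also have "\<dots> \<le> \<bar>a - b\<bar>" using iexp_approx1[of "a - b" 0] by simp
  finally show ?thesis .
qed

text \<open>Isolates what the limit theorem needs of the weights. The products
  \<open>\<Prod>B\<close> range over the squarefree numbers; the error \<open>E / n\<close> is
  informative only for those small against \<open>n\<close>, and \<open>upper\<close> controls the
  rest.\<close>

locale equidistributed_weights =
  fixes w :: "nat \<Rightarrow> nat \<Rightarrow> real" and E :: real
  assumes nonneg: "\<And>n i. n > 1 \<Longrightarrow> i \<in> {1..n} \<Longrightarrow> 0 \<le> w n i"
    and upper: "\<And>n i. n > 1 \<Longrightarrow> i \<in> {1..n} \<Longrightarrow> w n i \<le> 2 / real n"
    and total: "\<And>n. n > 1 \<Longrightarrow> (\<Sum>i = 1..n. w n i) = 1"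
    and equidistributed: "\<And>n B. n > 1 \<Longrightarrow> finite B \<Longrightarrow> (\<And>p. p \<in> B \<Longrightarrow> prime p) \<Longrightarrow>
      \<bar>multiples_mass (w n) n (\<Prod>B) - 1 / real (\<Prod>B)\<bar> \<le> E / real n"
begin

text \<open>There are at most \<open>n / d\<close> multiples, each of weight at most
  \<open>2 / n\<close>. Together the bounds say that the mass differs from \<open>1 / d\<close> by
  at most \<open>1 / d\<close>, the form needed for the large subsets.\<close>

lemma multiples_mass_bounds:
  assumes "n > 1" "d > 0"
  shows "0 \<le> multiples_mass (w n) n d" "multiples_mass (w n) n d \<le> 2 / real d"
proof -
  show "0 \<le> multiples_mass (w n) n d"
    unfolding multiples_mass_def using nonneg assms by (intro sum_nonneg) auto
  have "multiples_mass (w n) n d \<le> (\<Sum>l = 1..n div d. 2 / real n)"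
    unfolding multiples_mass_eq_sum[OF assms(2)]
  proof (rule sum_mono)
    fix l assume l: "l \<in> {1..n div d}"
    then have "l * d \<le> n div d * d" by simp
    also have "\<dots> \<le> n" by simp
    finally have "l * d \<in> {1..n}" using l assms by (simp add: Suc_le_eq)
    then show "w n (l * d) \<le> 2 / real n" using upper assms by blast
  qed
  also have "\<dots> = real (n div d) * (2 / real n)" by simp
  also have "\<dots> \<le> real n / real d * (2 / real n)"
    by (intro mult_right_mono of_nat_div_le_of_nat) simp
  also have "\<dots> = 2 / real d" using assms by simp
  finally show "multiples_mass (w n) n d \<le> 2 / real d" .
qed

text \<open>\<open>iexp\<close> is 1-Lipschitz, so dropping the primes above the cutoff costs at
  most \<open>\<bar>\<theta>\<bar>\<close> times the expected number of prime factors above it; each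
  such prime \<open>p\<close> contributes at most \<open>2 / p\<close> to that expectation.\<close>

lemma large_primes_contribution:
  assumes "n > 1" "loglog n \<ge> 2"
  shows "norm ((\<Sum>i = 1..n. of_real (w n i) * iexp (\<theta> * real (omega i))) -
               (\<Sum>i = 1..n. of_real (w n i) * iexp \<theta> ^ card {p \<in> primes_le (cutoff n). p dvd i}))
         \<le> \<bar>\<theta>\<bar> * (2 * (full_sum n - small_sum n))"
proof -
  let ?A = "primes_le (cutoff n)" and ?F = "primes_le (real n)"
  have sub: "?A \<subseteq> ?F" using cutoff_bounds[OF assms] by (auto simp: primes_le_def)
  have omega: "real (omega i) = real (card {p \<in> ?A. p dvd i}) + real (card {p \<in> ?F - ?A. p dvd i})"
    if i: "i \<in> {1..n}" for i
  proof -
    have "prime_factors i = {p \<in> ?F. p dvd i}"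
    proof (rule Set.set_eqI)
      fix p
      have "p \<le> n" if "p dvd i" using that i dvd_imp_le[of p i] by simp
      then show "p \<in> prime_factors i \<longleftrightarrow> p \<in> {p \<in> ?F. p dvd i}"
        using i by (auto simp: in_prime_factors_iff primes_le_def)
    qed
    also have "\<dots> = {p \<in> ?A. p dvd i} \<union> {p \<in> ?F - ?A. p dvd i}" using sub by auto
    finally have "omega i = card ({p \<in> ?A. p dvd i} \<union> {p \<in> ?F - ?A. p dvd i})"
      by (simp add: omega_def)
    also have "\<dots> = card {p \<in> ?A. p dvd i} + card {p \<in> ?F - ?A. p dvd i}"
      by (rule card_Un_disjoint) auto
    finally show ?thesis by simp
  qed
  have "norm ((\<Sum>i = 1..n. of_real (w n i) * iexp (\<theta> * real (omega i))) -
        (\<Sum>i = 1..n. of_real (w n i) * iexp \<theta> ^ card {p \<in> ?A. p dvd i}))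
      \<le> (\<Sum>i = 1..n. norm (of_real (w n i) * iexp (\<theta> * real (omega i)) -
          of_real (w n i) * iexp \<theta> ^ card {p \<in> ?A. p dvd i}))"
    unfolding sum_subtractf[symmetric] by (rule norm_sum)
  also have "\<dots> \<le> (\<Sum>i = 1..n. \<bar>\<theta>\<bar> * (\<Sum>p\<in>?F - ?A. if p dvd i then w n i else 0))"
  proof (rule sum_mono)
    fix i assume i: "i \<in> {1..n}"
    have "iexp \<theta> ^ card {p \<in> ?A. p dvd i} = iexp (\<theta> * real (card {p \<in> ?A. p dvd i}))"
      by (simp add: exp_of_nat_mult[symmetric] mult_ac)
    then have "norm (of_real (w n i) * iexp (\<theta> * real (omega i)) - of_real (w n i) * iexp \<theta> ^ card {p \<in> ?A. p dvd i})
        = w n i * norm (iexp (\<theta> * real (omega i)) - iexp (\<theta> * real (card {p \<in> ?A. p dvd i})))"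
      using nonneg[OF assms(1) i] by (simp add: norm_mult right_diff_distrib[symmetric])
    also have "\<dots> \<le> w n i * \<bar>\<theta> * real (omega i) - \<theta> * real (card {p \<in> ?A. p dvd i})\<bar>"
      using nonneg[OF assms(1) i] by (intro mult_left_mono iexp_diff_le)
    also have "\<theta> * real (omega i) - \<theta> * real (card {p \<in> ?A. p dvd i}) = \<theta> * real (card {p \<in> ?F - ?A. p dvd i})"
      by (simp add: omega[OF i] distrib_left)
    also have "w n i * \<bar>\<theta> * real (card {p \<in> ?F - ?A. p dvd i})\<bar> = \<bar>\<theta>\<bar> * (real (card {p \<in> ?F - ?A. p dvd i}) * w n i)"
      by (simp add: abs_mult)
    also have "real (card {p \<in> ?F - ?A. p dvd i}) * w n i = (\<Sum>p\<in>?F - ?A. if p dvd i then w n i else 0)"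
      by (subst sum.inter_filter[symmetric]) auto
    finally show "norm (of_real (w n i) * iexp (\<theta> * real (omega i)) - of_real (w n i) * iexp \<theta> ^ card {p \<in> ?A. p dvd i})
        \<le> \<bar>\<theta>\<bar> * (\<Sum>p\<in>?F - ?A. if p dvd i then w n i else 0)" .
  qed
  also have "\<dots> = \<bar>\<theta>\<bar> * (\<Sum>p\<in>?F - ?A. \<Sum>i = 1..n. if p dvd i then w n i else 0)"
    unfolding sum_distrib_left[symmetric] by (subst sum.swap) simp
  also have "\<dots> = \<bar>\<theta>\<bar> * (\<Sum>p\<in>?F - ?A. multiples_mass (w n) n p)"
    unfolding multiples_mass_def by (subst sum.inter_filter) auto
  also have "\<dots> \<le> \<bar>\<theta>\<bar> * (\<Sum>p\<in>?F - ?A. 2 * (1 / real p))"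
  proof (intro mult_left_mono sum_mono)
    fix p assume "p \<in> ?F - ?A"
    then have "p > 0" using prime_gt_0_nat by (auto simp: primes_le_def)
    then show "multiples_mass (w n) n p \<le> 2 * (1 / real p)"
      using multiples_mass_bounds[OF assms(1)] by simp
  qed simp
  also have "\<dots> = \<bar>\<theta>\<bar> * (2 * (full_sum n - small_sum n))"
    unfolding full_sum_def small_sum_def sum_distrib_left[symmetric]
    using sub by (subst sum_diff) auto
  finally show ?thesis .
qed

lemma small_primes_contribution:
  fixes z :: complex
  assumes "n > 1" "loglog n \<ge> 2" "ln (real n) > 0" and z: "norm z \<le> 1"
  shows "norm ((\<Sum>i = 1..n. of_real (w n i) * (1 + z) ^ card {p \<in> primes_le (cutoff n). p dvd i}) -
               (\<Prod>p\<in>primes_le (cutoff n). 1 + z / of_nat p))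
         \<le> E * real n powr (- 1 / 2) + exp (exp 1 * norm z * small_sum n - (loglog n - 1))"
proof -
  let ?A = "primes_le (cutoff n)"
  \<comment> \<open>Rounding down keeps \<open>cutoff n ^ K\<close> within
    \<open>n powr (1 / loglog n)\<close>, while the tail exponent loses at most 1.\<close>
  define K where "K = nat \<lfloor>loglog n\<rfloor>"
  have K: "real K \<le> loglog n" "real K \<ge> loglog n - 1"
    unfolding K_def using assms by linarith+
  note y = cutoff_bounds[OF assms(1,2)]
  have pos: "\<Prod>B > 0" if "B \<subseteq> ?A" for B
    using that prime_gt_0_nat by (intro prod_pos) (auto simp: primes_le_def)
  have "norm ((\<Sum>i = 1..n. of_real (w n i) * (1 + z) ^ card {p \<in> ?A. p dvd i}) - (\<Prod>p\<in>?A. 1 + z / of_nat p))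
      \<le> E / real n * cutoff n ^ K + exp (exp 1 * norm z * (\<Sum>p\<in>?A. 1 / real p) - real K)"
  proof (rule truncated_expansion_bound)
    fix B assume B: "B \<subseteq> ?A"
    show "\<bar>multiples_mass (w n) n (\<Prod>B) - 1 / real (\<Prod>B)\<bar> \<le> E / real n"
      using B assms(1) by (intro equidistributed) (auto simp: primes_le_def intro: finite_subset[OF B])
    have "2 / real (\<Prod>B) = 1 / real (\<Prod>B) + 1 / real (\<Prod>B)" by simp
    then show "\<bar>multiples_mass (w n) n (\<Prod>B) - 1 / real (\<Prod>B)\<bar> \<le> 1 / real (\<Prod>B)"
      using multiples_mass_bounds[OF assms(1) pos[OF B]] by linarith
  qed (use y z in \<open>auto simp: mem_primes_le_iff\<close>)
  moreover have "E / real n * cutoff n ^ K \<le> E * real n powr (- 1 / 2)"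
  proof -
    \<comment> \<open>The locale fixes no sign for \<open>E\<close>; the empty set of primes reveals
      it.\<close>
    have E: "E \<ge> 0"
      using order_trans[OF abs_ge_zero equidistributed[of n "{}"]] assms(1) by (simp add: zero_le_divide_iff)
    have "cutoff n ^ K = cutoff n powr real K" using y by (simp add: powr_realpow)
    also have "\<dots> \<le> cutoff n powr loglog n" using y K by (intro powr_mono) auto
    also have "\<dots> = real n powr (1 / loglog n)"
      using assms by (simp add: cutoff_def powr_powr power2_eq_square)
    also have "\<dots> \<le> real n powr (1 / 2)"
      using assms by (intro powr_mono divide_left_mono) auto
    finally have "cutoff n ^ K / real n \<le> real n powr (1 / 2) / real n powr 1"
      using assms by (simp add: divide_right_mono)
    also have "\<dots> = real n powr (- 1 / 2)" by (simp only: powr_diff[symmetric]) simp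
    finally have "E * (cutoff n ^ K / real n) \<le> E * real n powr (- 1 / 2)"
      using E by (rule mult_left_mono)
    then show ?thesis by simp
  qed
  moreover have "exp (exp 1 * norm z * (\<Sum>p\<in>?A. 1 / real p) - real K) \<le> exp (exp 1 * norm z * small_sum n - (loglog n - 1))"
    using K by (simp add: small_sum_def)
  ultimately show ?thesis by linarith
qed

lemma characteristic_function_limit:
  "(\<lambda>n. \<Sum>i = 1..n. of_real (w n i) * iexp (t * ((real (omega i) - loglog n) / sqrt (loglog n))))
     \<longlonglongrightarrow> of_real (exp (- (t\<^sup>2) / 2))"
    (is "?S \<longlonglongrightarrow> _")
proof -
  define \<theta> where "\<theta> n = t / sqrt (loglog n)" for n
  define z where "z n = iexp (\<theta> n) - 1" for n
  define R where "R n = iexp (- t * sqrt (loglog n)) * exp (z n * of_real (small_sum n))" for n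
  \<comment> \<open>One summand per replacement: large primes dropped, expectation replaced by the
    product, product replaced by the exponential.\<close>
  define B where "B n = 2 * \<bar>t\<bar> * ((full_sum n - loglog n) / sqrt (loglog n) - (small_sum n - loglog n) / sqrt (loglog n))
    + (E * real n powr (- 1 / 2) +
       exp (exp 1 * (\<bar>t\<bar> / sqrt (loglog n)) * (exp (1 / loglog n) * (loglog n + ln (loglog n) + ln 2 + 2)) - (loglog n - 1)))
    + 6 * (\<bar>t\<bar> / sqrt (loglog n)) ^ 2" for n
  have R: "R \<longlonglongrightarrow> of_real (exp (- (t\<^sup>2) / 2))"
    unfolding R_def z_def \<theta>_def by (rule exp_small_sum_limit)
  have \<theta>_lim: "(\<lambda>n. \<bar>t\<bar> / sqrt (loglog n)) \<longlonglongrightarrow> 0"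
    by (rule filterlim_compose[OF _ loglog_at_top]) real_asymp
  have "B \<longlonglongrightarrow> 2 * \<bar>t\<bar> * (0 - 0) + (0 + 0) + 6 * 0 ^ 2"
    unfolding B_def
  proof (intro tendsto_add tendsto_mult tendsto_const tendsto_diff tendsto_power sum_asymptotics \<theta>_lim)
    show "(\<lambda>n. E * real n powr (- 1 / 2)) \<longlonglongrightarrow> 0" by real_asymp
    \<comment> \<open>The positive part of the exponent is \<open>O(sqrt L)\<close> and is beaten by
      \<open>- L\<close>.\<close>
    show "(\<lambda>n. exp (exp 1 * (\<bar>t\<bar> / sqrt (loglog n)) * (exp (1 / loglog n) * (loglog n + ln (loglog n) + ln 2 + 2)) -
        (loglog n - 1))) \<longlonglongrightarrow> 0"
      by (rule filterlim_compose[OF _ loglog_at_top]) real_asymp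
  qed
  then have B: "B \<longlonglongrightarrow> 0" by simp
  have "(\<lambda>n. ?S n - R n) \<longlonglongrightarrow> 0"
  proof (rule Lim_null_comparison[OF _ B])
    have "eventually (\<lambda>n. \<bar>t\<bar> / sqrt (loglog n) < 1) sequentially"
      using \<theta>_lim by (rule order_tendstoD) simp
    with eventually_large show "eventually (\<lambda>n. norm (?S n - R n) \<le> B n) sequentially"
    proof eventually_elim
      case (elim n)
      let ?A = "primes_le (cutoff n)"
      define s where "s = sqrt (loglog n)"
      have s: "s > 0" "loglog n = s * s" using elim by (simp_all add: s_def)
      have n: "n > 1" "loglog n \<ge> 2" "ln (real n) > 0" using elim by auto
      \<comment> \<open>\<open>S0\<close> is the uncentred characteristic function,
        \<open>S1\<close> the same with only the primes up to the cutoff counted, and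
        \<open>P\<close> its product model.\<close>
      define S0 S1 P where "S0 = (\<Sum>i = 1..n. of_real (w n i) * iexp (\<theta> n * real (omega i)))"
        and "S1 = (\<Sum>i = 1..n. of_real (w n i) * (1 + z n) ^ card {p \<in> ?A. p dvd i})"
        and "P = (\<Prod>p\<in>?A. 1 + z n / of_nat p)"
      have abs\<theta>: "\<bar>\<theta> n\<bar> = \<bar>t\<bar> / s" using s(1) by (simp add: \<theta>_def s_def[symmetric])
      have z_le: "norm (z n) \<le> \<bar>t\<bar> / s"
        using iexp_diff_le[of "\<theta> n" 0] by (simp add: z_def abs\<theta>)
      also have "\<bar>t\<bar> / s < 1" using elim by (simp only: s_def)
      finally have z1: "norm (z n) \<le> 1" by simp
      \<comment> \<open>Centring multiplies by a phase of modulus 1 that \<open>R n\<close> carries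
        too, so the comparison can be made without it.\<close>
      have shift: "?S n = iexp (- t * s) * S0"
        unfolding S0_def sum_distrib_left
      proof (rule sum.cong[OF refl])
        fix i
        have "t * ((real (omega i) - loglog n) / sqrt (loglog n)) =
            - t * (loglog n / s) + \<theta> n * real (omega i)"
          by (simp add: \<theta>_def s_def diff_divide_distrib right_diff_distrib)
        also have "loglog n / s = s" using s by simp
        finally have "t * ((real (omega i) - loglog n) / sqrt (loglog n)) = - t * s + \<theta> n * real (omega i)" .
        then show "of_real (w n i) * iexp (t * ((real (omega i) - loglog n) / sqrt (loglog n))) =
            iexp (- t * s) * (of_real (w n i) * iexp (\<theta> n * real (omega i)))"
          by (simp only: of_real_add distrib_left exp_add mult.left_commute)
      qed
      have "norm (?S n - R n) = norm (S0 - exp (z n * of_real (small_sum n)))"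
        unfolding shift unfolding R_def s_def[symmetric] right_diff_distrib[symmetric] norm_mult by simp
      also have "S0 - exp (z n * of_real (small_sum n)) =
          (S0 - S1) + (S1 - P) + (P - exp (z n * of_real (small_sum n)))" by simp
      also have "norm \<dots> \<le> norm (S0 - S1) + norm (S1 - P) + norm (P - exp (z n * of_real (small_sum n)))"
        by (intro order_trans[OF norm_triangle_ineq] add_mono order_refl norm_triangle_ineq)
      also have "\<dots> \<le> B n"
        unfolding B_def
      proof (intro add_mono)
        have "norm (S0 - S1) \<le> \<bar>\<theta> n\<bar> * (2 * (full_sum n - small_sum n))"
          unfolding S0_def S1_def using large_primes_contribution[OF n(1,2), of "\<theta> n"] by (simp add: z_def)
        also have "\<dots> = 2 * \<bar>t\<bar> * ((full_sum n - loglog n) / sqrt (loglog n) - (small_sum n - loglog n) / sqrt (loglog n))"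
        proof -
          have "(full_sum n - loglog n) / sqrt (loglog n) - (small_sum n - loglog n) / sqrt (loglog n) =
              (full_sum n - small_sum n) / s"
            unfolding s_def by (simp add: diff_divide_distrib)
          then show ?thesis by (simp add: abs\<theta>)
        qed
        finally show "norm (S0 - S1) \<le> 2 * \<bar>t\<bar> * ((full_sum n - loglog n) / sqrt (loglog n) - (small_sum n - loglog n) / sqrt (loglog n))" .
        have "exp 1 * norm (z n) * small_sum n \<le>
            exp 1 * (\<bar>t\<bar> / sqrt (loglog n)) * (exp (1 / loglog n) * (loglog n + ln (loglog n) + ln 2 + 2))"
        proof (rule mult_mono)
          show "exp 1 * norm (z n) \<le> exp 1 * (\<bar>t\<bar> / sqrt (loglog n))"
            using z_le by (intro mult_left_mono) (simp_all add: s_def)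
          show "small_sum n \<le> exp (1 / loglog n) * (loglog n + ln (loglog n) + ln 2 + 2)"
            using sum_bounds[OF n] by linarith
          show "0 \<le> small_sum n" unfolding small_sum_def by (intro sum_nonneg) simp
          show "0 \<le> exp 1 * (\<bar>t\<bar> / sqrt (loglog n))" using n by simp
        qed
        then have exp_le: "exp (exp 1 * norm (z n) * small_sum n - (loglog n - 1)) \<le>
            exp (exp 1 * (\<bar>t\<bar> / sqrt (loglog n)) * (exp (1 / loglog n) * (loglog n + ln (loglog n) + ln 2 + 2)) - (loglog n - 1))"
          unfolding exp_le_cancel_iff by (rule diff_right_mono)
        have "norm (S1 - P) \<le> E * real n powr (- 1 / 2) + exp (exp 1 * norm (z n) * small_sum n - (loglog n - 1))"
          using small_primes_contribution[OF n z1] unfolding S1_def P_def .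
        also note add_left_mono[OF exp_le]
        finally show "norm (S1 - P) \<le> E * real n powr (- 1 / 2) +
            exp (exp 1 * (\<bar>t\<bar> / sqrt (loglog n)) * (exp (1 / loglog n) * (loglog n + ln (loglog n) + ln 2 + 2)) - (loglog n - 1))" .
        have "norm (P - exp (z n * of_real (small_sum n))) \<le> 6 * norm (z n) ^ 2"
          unfolding P_def small_sum_def using z1 by (intro prod_one_plus_div_primes_approx) (simp_all add: z_def)
        also have "\<dots> \<le> 6 * (\<bar>t\<bar> / s) ^ 2"
          using z_le by (intro mult_left_mono power_mono) auto
        finally show "norm (P - exp (z n * of_real (small_sum n))) \<le> 6 * (\<bar>t\<bar> / sqrt (loglog n)) ^ 2"
          by (simp add: s_def)
      qed
      finally show ?case .
    qed
  qed
  from tendsto_add[OF this R] show ?thesis by simp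
qed

text \<open>Levy's continuity theorem turns the limit of the characteristic functions into
  convergence of the distribution functions.\<close>

theorem erdos_kac:
  "(\<lambda>n. \<Sum>i\<in>{i \<in> {1..n}. (real (omega i) - loglog n) / sqrt (loglog n) \<le> x}. w n i)
     \<longlonglongrightarrow> cdf std_normal_distribution x"
proof -
  \<comment> \<open>For \<open>n \<le> 1\<close> nothing is known of \<open>w n\<close>, yet
    \<open>Q n\<close> is a pmf by its type, so that \<open>M n\<close> is a distribution for every
    \<open>n\<close>; only large \<open>n\<close> affect the limits.\<close>
  define Q where "Q n = embed_pmf (\<lambda>i. if i \<in> {1..n} then w n i else 0)" for n
  define g where "g n i = (real (omega i) - loglog n) / sqrt (loglog n)" for n i
  define M where "M n = distr (measure_pmf (Q n)) borel (g n)" for n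
  have pmf_Q: "pmf (Q n) i = (if i \<in> {1..n} then w n i else 0)" if "n > 1" for n i
    unfolding Q_def
  proof (rule pmf_embed_pmf)
    have "(\<integral>\<^sup>+i. ennreal (if i \<in> {1..n} then w n i else 0) \<partial>count_space UNIV) =
        (\<Sum>i\<in>{1..n}. ennreal (if i \<in> {1..n} then w n i else 0))"
      by (rule nn_integral_count_space') auto
    also have "\<dots> = (\<Sum>i\<in>{1..n}. ennreal (w n i))" by (intro sum.cong) auto
    also have "\<dots> = ennreal (\<Sum>i\<in>{1..n}. w n i)" using nonneg that by (intro sum_ennreal) auto
    finally show "(\<integral>\<^sup>+i. ennreal (if i \<in> {1..n} then w n i else 0) \<partial>count_space UNIV) = 1"
      using total[OF that] by simp
  qed (use nonneg that in auto)
  have set_Q: "set_pmf (Q n) \<subseteq> {1..n}" if "n > 1" for n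
  proof
    fix i assume "i \<in> set_pmf (Q n)"
    then have "pmf (Q n) i \<noteq> 0" by (simp add: set_pmf_iff)
    then show "i \<in> {1..n}" by (metis pmf_Q[OF that])
  qed
  have M: "real_distribution (M n)" for n
    unfolding M_def by (intro prob_space.real_distribution_distr measure_pmf.prob_space_axioms) simp
  interpret N: real_distribution std_normal_distribution by (rule real_dist_normal_dist)
  have "weak_conv_m M std_normal_distribution"
  proof (rule levy_continuity[OF M real_dist_normal_dist])
    fix t
    have "(\<lambda>n. char (M n) t) \<longlonglongrightarrow> of_real (exp (- (t\<^sup>2) / 2))"
    proof (rule Lim_transform_eventually[OF characteristic_function_limit[of t]])
      show "eventually (\<lambda>n. (\<Sum>i = 1..n. of_real (w n i) * iexp (t * ((real (omega i) - loglog n) / sqrt (loglog n)))) =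
          char (M n) t) sequentially"
        using eventually_gt_at_top[of 1]
      proof eventually_elim
        case (elim n)
        have "char (M n) t = (CLINT i|measure_pmf (Q n). iexp (t * g n i))"
          unfolding M_def char_def by (subst integral_distr) auto
        also have "\<dots> = (\<Sum>i\<in>{1..n}. pmf (Q n) i *\<^sub>R iexp (t * g n i))"
          using set_Q[OF elim] by (intro integral_measure_pmf) auto
        also have "\<dots> = (\<Sum>i\<in>{1..n}. of_real (w n i) * iexp (t * g n i))"
          by (intro sum.cong refl) (simp add: pmf_Q[OF elim] scaleR_conv_of_real)
        finally show ?case by (simp add: g_def)
      qed
    qed
    then show "(\<lambda>n. char (M n) t) \<longlonglongrightarrow> char std_normal_distribution t"
      by (simp add: char_std_normal_distribution)
  qed
  \<comment> \<open>Weak convergence gives the limit only at continuity points; the normal law has a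
    density and hence no atoms.\<close>
  moreover have "isCont (cdf std_normal_distribution) x"
  proof -
    have "absolutely_continuous lborel std_normal_distribution"
      by (rule absolutely_continuousI_density) simp
    moreover have "{x} \<in> null_sets lborel" by (rule finite_imp_null_set_lborel) simp
    ultimately have "{x} \<in> null_sets std_normal_distribution"
      unfolding absolutely_continuous_def by blast
    then have "emeasure std_normal_distribution {x} = 0" by (rule null_setsD1)
    then show ?thesis unfolding N.isCont_cdf by (simp add: measure_def)
  qed
  ultimately have "(\<lambda>n. cdf (M n) x) \<longlonglongrightarrow> cdf std_normal_distribution x"
    by (simp add: weak_conv_m_def weak_conv_def)
  then show ?thesis
  proof (rule Lim_transform_eventually)
    show "eventually (\<lambda>n. cdf (M n) x = (\<Sum>i\<in>{i \<in> {1..n}. (real (omega i) - loglog n) / sqrt (loglog n) \<le> x}. w n i))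
        sequentially"
      using eventually_gt_at_top[of 1]
    proof eventually_elim
      case (elim n)
      have "cdf (M n) x = measure (measure_pmf (Q n)) {i. g n i \<le> x}"
        unfolding M_def cdf_def by (subst measure_distr) (auto simp: vimage_def)
      also have "\<dots> = measure (measure_pmf (Q n)) {i \<in> {1..n}. g n i \<le> x}"
        using set_Q[OF elim] by (intro measure_prob_cong_0) (auto simp: pmf_Q[OF elim])
      also have "\<dots> = (\<Sum>i\<in>{i \<in> {1..n}. g n i \<le> x}. pmf (Q n) i)"
        by (rule measure_measure_pmf_finite) simp
      also have "\<dots> = (\<Sum>i\<in>{i \<in> {1..n}. g n i \<le> x}. w n i)"
        by (intro sum.cong refl) (simp add: pmf_Q[OF elim])
      finally show ?case by (simp add: g_def)
    qed
  qed
qed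

end

section \<open>Equidistribution of the reflected weights\<close>

lemma div_over_self_approx:
  assumes "n > 0" "d > 0"
  shows "\<bar>real (n div d) / real n - 1 / real d\<bar> \<le> 1 / real n"
proof -
  have "real (n div d) * real d + real (n mod d) = real n"
    by (simp flip: of_nat_mult of_nat_add)
  then have "real (n mod d) = real n - real (n div d) * real d" by linarith
  then have "1 / real d - real (n div d) / real n = real (n mod d) / real d / real n"
    using assms by (simp add: field_simps)
  moreover have "real (n mod d) / real d \<le> 1" using assms by simp
  then have "real (n mod d) / real d / real n \<le> 1 / real n" by (rule divide_right_mono) simp
  moreover have "0 \<le> real (n mod d) / real d / real n" by simp
  ultimately show ?thesis by linarith
qed

text \<open>Conditions (c) and (d) bound \<epsilon> and its sums symmetrically from both sides, so
  they survive the change of sign in the reflection and make the reflected weights an instance of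
  the locale.\<close>

theorem theorem4:
  fixes P :: "nat \<Rightarrow> nat pmf" and \<epsilon> :: "nat \<Rightarrow> nat \<Rightarrow> real"
  assumes supp: "\<And>n. n > 1 \<Longrightarrow> set_pmf (P n) \<subseteq> {1..n}"
    and mass: "\<And>n i. n > 1 \<Longrightarrow> i \<in> {1..n} \<Longrightarrow> pmf (P n) i = 1 / real n + \<epsilon> i n"
    and a: "\<exists>C::real. \<forall>n>1. \<forall>p. prime p \<and> real p > alpha n \<longrightarrow>
              (\<Sum>l = 1..n div p. \<epsilon> (l * p) n) \<le> C / real p"
    and b: "\<And>p::nat. prime p \<Longrightarrow> (\<lambda>n. \<Sum>l = 1..n div p. \<epsilon> (l * p) n) \<longlonglongrightarrow> 0"
    and c: "\<And>n i. n > 1 \<Longrightarrow> i \<in> {1..n} \<Longrightarrow> \<epsilon> i n \<in> {- (1 / real n)..1 / real n}"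
    and d: "\<exists>D::real. D \<ge> 0 \<and> (\<forall>n>1. \<forall>ps::nat list.
              ps \<noteq> [] \<and> distinct ps \<and> (\<forall>p\<in>set ps. prime p) \<longrightarrow>
              - (D / real n) \<le> (\<Sum>l = 1..n div prod_list ps. \<epsilon> (l * prod_list ps) n) \<and>
              (\<Sum>l = 1..n div prod_list ps. \<epsilon> (l * prod_list ps) n) \<le> D / real n)"
  shows "\<forall>x::real.
    (\<lambda>n. reflected_prob \<epsilon> n
           {m. real (omega m) - ln (ln (real n)) \<le> x * ln (ln (real n)) powr (1 / 2)})
      \<longlonglongrightarrow> cdf std_normal_distribution x"
proof
  fix x :: real
  from d obtain D :: real where "D \<ge> 0" and D: "\<forall>n>1. \<forall>ps::nat list.
      ps \<noteq> [] \<and> distinct ps \<and> (\<forall>p\<in>set ps. prime p) \<longrightarrow>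
      - (D / real n) \<le> (\<Sum>l = 1..n div prod_list ps. \<epsilon> (l * prod_list ps) n) \<and>
      (\<Sum>l = 1..n div prod_list ps. \<epsilon> (l * prod_list ps) n) \<le> D / real n"
    by blast
  have total: "(\<Sum>i = 1..n. reflected_mass \<epsilon> n i) = 1" if "n > 1" for n
    using reflected_mass_pmf(2)[of n "P n" \<epsilon>] that supp mass c by (simp add: reflected_prob_def)
  \<comment> \<open>\<open>D\<close> comes from (d), the extra 1 from rounding \<open>n / d\<close>
    down to the number of multiples of \<open>d\<close>.\<close>
  interpret equidistributed_weights "reflected_mass \<epsilon>" "D + 1"
  proof
    fix n i :: nat assume n: "n > 1"
    show "(\<Sum>i = 1..n. reflected_mass \<epsilon> n i) = 1"
      using n by (rule total)
    assume i: "i \<in> {1..n}"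
    show "0 \<le> reflected_mass \<epsilon> n i" using c[OF n i] by (simp add: reflected_mass_def)
    show "reflected_mass \<epsilon> n i \<le> 2 / real n"
      using c[OF n i] by (simp add: reflected_mass_def)
  next
    fix n :: nat and B :: "nat set"
    assume n: "n > 1" and B: "finite B" "\<And>p. p \<in> B \<Longrightarrow> prime p"
    show "\<bar>multiples_mass (reflected_mass \<epsilon> n) n (\<Prod>B) - 1 / real (\<Prod>B)\<bar> \<le> (D + 1) / real n"
    \<comment> \<open>Condition (d) starts at \<open>k = 1\<close>; the empty product is covered by
      the total mass, with error 0.\<close>
    proof (cases "B = {}")
      case True
      then have "multiples_mass (reflected_mass \<epsilon> n) n (\<Prod>B) = 1"
        using total[OF n] multiples_mass_eq_sum[of 1 "reflected_mass \<epsilon> n" n] by simp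
      with True \<open>D \<ge> 0\<close> show ?thesis by simp
    next
      case False
      define ps where "ps = sorted_list_of_set B"
      have ps: "set ps = B" "distinct ps" "ps \<noteq> []"
        using B False by (auto simp: ps_def)
      have prod: "prod_list ps = \<Prod>B"
        using prod.distinct_set_conv_list[of ps "\<lambda>p. p"] ps by simp
      have "\<Prod>B > 0" using B(2) prime_gt_0_nat by (intro prod_pos) blast
      then have "multiples_mass (reflected_mass \<epsilon> n) n (\<Prod>B) =
          real (n div \<Prod>B) / real n - (\<Sum>l = 1..n div \<Prod>B. \<epsilon> (l * \<Prod>B) n)"
        by (simp only: multiples_mass_eq_sum reflected_mass_def sum_subtractf) simp
      moreover have "\<bar>\<Sum>l = 1..n div \<Prod>B. \<epsilon> (l * \<Prod>B) n\<bar> \<le> D / real n"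
        using D[rule_format, OF n, of ps] ps B(2) unfolding prod by (simp add: abs_le_iff)
      moreover have "\<bar>real (n div \<Prod>B) / real n - 1 / real (\<Prod>B)\<bar> \<le> 1 / real n"
        using n \<open>\<Prod>B > 0\<close> by (intro div_over_self_approx) simp_all
      moreover have "(D + 1) / real n = D / real n + 1 / real n"
        by (rule add_divide_distrib)
      ultimately show ?thesis by linarith
    qed
  qed
  show "(\<lambda>n. reflected_prob \<epsilon> n
      {m. real (omega m) - ln (ln (real n)) \<le> x * ln (ln (real n)) powr (1 / 2)})
      \<longlonglongrightarrow> cdf std_normal_distribution x"
  proof (rule Lim_transform_eventually[OF erdos_kac])
    show "eventually (\<lambda>n. (\<Sum>i\<in>{i \<in> {1..n}. (real (omega i) - loglog n) / sqrt (loglog n) \<le> x}. reflected_mass \<epsilon> n i) =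
        reflected_prob \<epsilon> n {m. real (omega m) - ln (ln (real n)) \<le> x * ln (ln (real n)) powr (1 / 2)}) sequentially"
      using eventually_large
    proof eventually_elim
      case (elim n)
      then have L: "loglog n > 0" by simp
      \<comment> \<open>Multiplying by \<open>sqrt (loglog n)\<close> preserves the inequality once
        \<open>loglog n > 0\<close>, so the two events agree for all large \<open>n\<close>.\<close>
      have "{i \<in> {1..n}. (real (omega i) - loglog n) / sqrt (loglog n) \<le> x} =
          {m. real (omega m) - ln (ln (real n)) \<le> x * ln (ln (real n)) powr (1 / 2)} \<inter> {1..n}"
        using L by (auto simp: loglog_def powr_half_sqrt pos_divide_le_eq)
      then show ?case by (simp add: reflected_prob_def)
    qed
  qed
qed

end
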